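(* Let $G,H$ be graphs, let $P_G$ be a pleat of $G$ and $P_H$ a pleat of $H$. Then $G$ and $H$ are homotopy equivalent if and only if $P_G$ and $P_H$ are isomorphic.
   Context: A graph is a finite undirected graph, loops allowed, at most one edge between two vertices; a graph morphism is a vertex map preserving edges. $N(u)$ is the set of vertices adjacent to $u$ ($u\in N(u)$ iff $u$ is looped). The exponential graph $H^G$ has as vertices the set maps $V(G)\to V(H)$, with $f\text{---}g$ iff $f(v_1)\text{---}g(v_2)$ for every edge $v_1\text{---}v_2$ of $G$ (loops included). Morphisms $f,g:G\to H$ are homotopic if there is a sequence of graph morphisms $f=f_0,\dots,f_n=g$ with $f_i\text{---}f_{i+1}$ in $H^G$. Graphs $G,H$ are homotopy equivalent if there are morphisms $f:G\to H$, $g:H\to G$ with $gf$ homotopic to $\mathrm{id}_G$ and $fg$ homotopic to $\mathrm{id}_H$. A graph is stiff if there are no two distinct vertices $v,w$ with $N(v)\subseteq N(w)$. A pleat of a graph $G$ is a stiff graph that is homotopy equivalent to $G$. *)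

theory Defs
  imports
    "HOL-Library.FuncSet"
    "Graph_Theory.Pair_Digraph"
    "Graph_Theory.Digraph_Isomorphism"
begin

text \<open>
  Finite undirected graphs with loops allowed and no multiple edges are the records satisfying
  \<^locale>\<open>pair_pseudo_graph\<close>: finite vertex set, symmetric set of arcs. An edge between
  distinct vertices appears as two opposite arcs, a loop as a single arc. The null graph is included.

  Set maps between vertex sets are represented by the extensional functions of
  \<^theory>\<open>HOL-Library.FuncSet\<close>, so that equality of maps is equality on the vertex set.
\<close>

definition nbhd :: "'a pair_pre_digraph \<Rightarrow> 'a \<Rightarrow> 'a set" where
  "nbhd G u = {v \<in> pverts G. (u, v) \<in> parcs G}"

definition graph_morphisms :: "'a pair_pre_digraph \<Rightarrow> 'b pair_pre_digraph \<Rightarrow> ('a \<Rightarrow> 'b) set" where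
  "graph_morphisms G H =
     {f \<in> pverts G \<rightarrow>\<^sub>E pverts H. \<forall>u v. (u, v) \<in> parcs G \<longrightarrow> (f u, f v) \<in> parcs H}"

text \<open>The exponential graph \<open>H\<^sup>G\<close>; its vertices are all set maps, not only the morphisms.\<close>

definition exp_graph ::
  "'b pair_pre_digraph \<Rightarrow> 'a pair_pre_digraph \<Rightarrow> ('a \<Rightarrow> 'b) pair_pre_digraph" where
  "exp_graph H G =
     \<lparr> pverts = pverts G \<rightarrow>\<^sub>E pverts H,
       parcs = {(f, g). f \<in> pverts G \<rightarrow>\<^sub>E pverts H \<and> g \<in> pverts G \<rightarrow>\<^sub>E pverts H \<and>
                  (\<forall>v1 v2. (v1, v2) \<in> parcs G \<longrightarrow> (f v1, g v2) \<in> parcs H)} \<rparr>"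

definition homotopic_morphisms ::
  "'a pair_pre_digraph \<Rightarrow> 'b pair_pre_digraph \<Rightarrow> ('a \<Rightarrow> 'b) \<Rightarrow> ('a \<Rightarrow> 'b) \<Rightarrow> bool" where
  "homotopic_morphisms G H f g \<longleftrightarrow>
     (\<exists>(n::nat) h. h 0 = f \<and> h n = g \<and>
        (\<forall>i\<le>n. h i \<in> graph_morphisms G H) \<and>
        (\<forall>i<n. (h i, h (Suc i)) \<in> parcs (exp_graph H G)))"

definition homotopy_equivalent_graphs ::
  "'a pair_pre_digraph \<Rightarrow> 'b pair_pre_digraph \<Rightarrow> bool" where
  "homotopy_equivalent_graphs G H \<longleftrightarrow>
     (\<exists>f \<in> graph_morphisms G H. \<exists>g \<in> graph_morphisms H G.
        homotopic_morphisms G G (compose (pverts G) g f) (\<lambda>x\<in>pverts G. x) \<and>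
        homotopic_morphisms H H (compose (pverts H) f g) (\<lambda>x\<in>pverts H. x))"

definition stiff :: "'a pair_pre_digraph \<Rightarrow> bool" where
  "stiff G \<longleftrightarrow> \<not> (\<exists>v\<in>pverts G. \<exists>w\<in>pverts G. v \<noteq> w \<and> nbhd G v \<subseteq> nbhd G w)"

definition pleat_of :: "'c pair_pre_digraph \<Rightarrow> 'a pair_pre_digraph \<Rightarrow> bool" where
  "pleat_of P G \<longleftrightarrow> pair_pseudo_graph P \<and> stiff P \<and> homotopy_equivalent_graphs P G"

lemma pair_pseudo_graph_exp_graph:
  assumes "pair_pseudo_graph G" "pair_pseudo_graph H"
  shows "pair_pseudo_graph (exp_graph H G)"
proof -
  interpret G: pair_pseudo_graph G by fact
  interpret H: pair_pseudo_graph H by fact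
  have fin: "finite (pverts G \<rightarrow>\<^sub>E pverts H)"
    by (intro finite_PiE G.pair_finite_verts H.pair_finite_verts)
  have sG: "sym (parcs G)" and sH: "sym (parcs H)"
    using G.pair_sym_arcs H.pair_sym_arcs by (simp_all add: symmetric_def)
  have "sym (parcs (exp_graph H G))"
    using symD[OF sG] symD[OF sH] unfolding sym_def exp_graph_def by auto
  moreover have "finite (parcs (exp_graph H G))"
    by (rule finite_subset[OF _ finite_cartesian_product[OF fin fin]]) (auto simp: exp_graph_def)
  ultimately show ?thesis
    using fin by unfold_locales (auto simp: exp_graph_def symmetric_def)
qed

text \<open>
  For graphs with pairs as arcs, the library's \<^const>\<open>digraph_iso\<close> is the usual isomorphism:
  a bijection of vertices that preserves and reflects adjacency.
\<close>

lemma digraph_iso_with_proj_iff: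
  assumes "pair_wf_digraph G" "pair_wf_digraph H"
  shows "digraph_iso (with_proj G) (with_proj H) \<longleftrightarrow>
    (\<exists>f. bij_betw f (pverts G) (pverts H) \<and>
      (\<forall>u\<in>pverts G. \<forall>v\<in>pverts G. (u, v) \<in> parcs G \<longleftrightarrow> (f u, f v) \<in> parcs H))"
    (is "?L \<longleftrightarrow> ?R")
proof
  assume ?L
  then obtain h where h: "pre_digraph.digraph_isomorphism (with_proj G) h"
    and H: "with_proj H = app_iso h (with_proj G)"
    unfolding digraph_iso_def by blast
  define f where "f = iso_verts h"
  have V: "pverts H = f ` pverts G" and A: "parcs H = iso_arcs h ` parcs G"
    and T: "iso_tail h = fst" and D: "iso_head h = snd"
    using H unfolding with_proj_def app_iso_def f_def by auto
  have inj: "inj_on f (pverts G)"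
    and arc: "\<And>a. a \<in> parcs G \<Longrightarrow> iso_arcs h a = (f (fst a), f (snd a))"
    using h T D unfolding pre_digraph.digraph_isomorphism_def f_def
    by (auto simp: prod_eq_iff)
  have wf: "\<And>u v. (u, v) \<in> parcs G \<Longrightarrow> u \<in> pverts G \<and> v \<in> pverts G"
    using assms(1) by (force simp: pair_wf_digraph_def)
  have "(u, v) \<in> parcs G \<longleftrightarrow> (f u, f v) \<in> parcs H"
    if uv: "u \<in> pverts G" "v \<in> pverts G" for u v
  proof
    assume "(u, v) \<in> parcs G"
    then show "(f u, f v) \<in> parcs H" using A arc by force
  next
    assume "(f u, f v) \<in> parcs H"
    then obtain a b where "(a, b) \<in> parcs G" "f u = f a" "f v = f b"
      using A arc by force
    then show "(u, v) \<in> parcs G" using wf uv inj by (metis inj_onD)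
  qed
  then show ?R using V inj by (auto simp: bij_betw_def)
next
  assume ?R
  then obtain f where f: "bij_betw f (pverts G) (pverts H)"
    and e: "\<And>u v. u \<in> pverts G \<Longrightarrow> v \<in> pverts G \<Longrightarrow> (u, v) \<in> parcs G \<longleftrightarrow> (f u, f v) \<in> parcs H"
    by blast
  have wfG: "\<And>u v. (u, v) \<in> parcs G \<Longrightarrow> u \<in> pverts G \<and> v \<in> pverts G"
    using assms(1) by (force simp: pair_wf_digraph_def)
  have wfH: "\<And>u v. (u, v) \<in> parcs H \<Longrightarrow> u \<in> pverts H \<and> v \<in> pverts H"
    using assms(2) by (force simp: pair_wf_digraph_def)
  define h where "h = \<lparr> iso_verts = f, iso_arcs = map_prod f f, iso_head = snd, iso_tail = fst \<rparr>"
  have inj: "inj_on f (pverts G)" and img: "f ` pverts G = pverts H"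
    using f by (auto simp: bij_betw_def)
  have "inj_on (map_prod f f) (parcs G)"
    using inj wfG by (auto simp: inj_on_def)
  then have "pre_digraph.digraph_isomorphism (with_proj G) h"
    using assms(1) inj unfolding pre_digraph.digraph_isomorphism_def h_def
    by (auto simp: wf_digraph_wp_iff)
  moreover have "map_prod f f ` parcs G = parcs H"
  proof (intro equalityI subsetI)
    fix x assume "x \<in> map_prod f f ` parcs G"
    then show "x \<in> parcs H" using wfG e by auto
  next
    fix x assume x: "x \<in> parcs H"
    obtain p q where pq: "x = (p, q)" by (cases x)
    with x wfH obtain u v where "u \<in> pverts G" "v \<in> pverts G" "p = f u" "q = f v"
      using img by (metis imageE)
    then show "x \<in> map_prod f f ` parcs G" using e x pq by force
  qed
  then have "with_proj H = app_iso h (with_proj G)"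
    using img unfolding with_proj_def app_iso_def h_def by simp
  ultimately show ?L unfolding digraph_iso_def by blast
qed

end

(* A morphism adjacent to the identity in the exponential graph satisfies N(v) \<subseteq> N(f v), so on a
   stiff graph it is the identity; walking along a homotopy, every morphism homotopic to the identity
   is the identity. Hence a homotopy equivalence between stiff graphs is an isomorphism, and the claim
   follows because homotopy equivalence is an equivalence relation. *)

theory Submission
  imports Defs
begin

lemma pair_wf_digraph_pseudo_graph: "pair_pseudo_graph G \<Longrightarrow> pair_wf_digraph G"
  unfolding pair_pseudo_graph_def pair_fin_digraph_def by blast

lemma arc_in_verts:
  assumes "pair_wf_digraph G" "(u, v) \<in> parcs G"
  shows "u \<in> pverts G" "v \<in> pverts G"
  using assms by (force simp: pair_wf_digraph_def)+

lemma identity_morphism: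
  assumes "pair_wf_digraph G"
  shows "(\<lambda>x\<in>pverts G. x) \<in> graph_morphisms G G"
  using arc_in_verts[OF assms] by (auto simp: graph_morphisms_def)

lemma compose_morphism:
  assumes "pair_wf_digraph G" "f \<in> graph_morphisms G H" "g \<in> graph_morphisms H K"
  shows "compose (pverts G) g f \<in> graph_morphisms G K"
  using assms arc_in_verts[OF assms(1)]
  by (fastforce simp: graph_morphisms_def compose_def)

lemma homotopic_morphisms_refl:
  "f \<in> graph_morphisms G H \<Longrightarrow> homotopic_morphisms G H f f"
  unfolding homotopic_morphisms_def by (intro exI[of _ 0] exI[of _ "\<lambda>_. f"]) simp

lemma homotopic_morphisms_trans:
  assumes "homotopic_morphisms G H a b" "homotopic_morphisms G H b c"
  shows "homotopic_morphisms G H a c"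
proof -
  obtain n h where h: "h 0 = a" "h n = b" "\<And>i. i \<le> n \<Longrightarrow> h i \<in> graph_morphisms G H"
    "\<And>i. i < n \<Longrightarrow> (h i, h (Suc i)) \<in> parcs (exp_graph H G)"
    using assms(1) unfolding homotopic_morphisms_def by blast
  obtain m k where k: "k 0 = b" "k m = c" "\<And>i. i \<le> m \<Longrightarrow> k i \<in> graph_morphisms G H"
    "\<And>i. i < m \<Longrightarrow> (k i, k (Suc i)) \<in> parcs (exp_graph H G)"
    using assms(2) unfolding homotopic_morphisms_def by blast
  \<comment> \<open>The concatenated walk. At \<open>i = n\<close> the two branches agree, since
    both homotopies pass through \<open>b\<close> there; \<open>l_right\<close> records this, so the
    step leaving index \<open>n\<close> can be read off from \<open>k\<close> alone.\<close>
  define l where "l i = (if i \<le> n then h i else k (i - n))" for i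
  have l_right: "l i = k (i - n)" if "n \<le> i" for i
    using that h(2) k(1) by (auto simp: l_def)
  have "l 0 = a" "l (n + m) = c"
    using h(1) k(2) l_right[of "n + m"] by (simp_all add: l_def)
  moreover have "\<forall>i\<le>n + m. l i \<in> graph_morphisms G H"
    using h(3) k(3) by (auto simp: l_def)
  moreover have "(l i, l (Suc i)) \<in> parcs (exp_graph H G)" if "i < n + m" for i
  proof (cases "i < n")
    case True
    then show ?thesis using h(4) by (simp add: l_def)
  next
    case False
    then show ?thesis using that k(4)[of "i - n"] by (simp add: l_right Suc_diff_le)
  qed
  ultimately show ?thesis unfolding homotopic_morphisms_def by blast
qed

text \<open>Composition on either side preserves adjacency in the exponential graph:
  \<open>f\<close> carries an edge of \<open>G\<close> to an edge of \<open>H\<close>, one step of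
  the homotopy turns that into an edge of \<open>K\<close>, and \<open>g\<close> carries it on to
  \<open>L\<close>. Hence the whole homotopy can be composed with \<open>f\<close> and
  \<open>g\<close> step by step. Both sides are treated at once because transitivity of homotopy
  equivalence needs exactly this sandwich.\<close>

lemma homotopic_morphisms_compose:
  assumes "pair_wf_digraph G" "pair_wf_digraph H"
    and f: "f \<in> graph_morphisms G H" and g: "g \<in> graph_morphisms K L"
    and "homotopic_morphisms H K a b"
  shows "homotopic_morphisms G L (compose (pverts G) g (compose (pverts G) a f))
           (compose (pverts G) g (compose (pverts G) b f))"
proof -
  obtain n h where h: "h 0 = a" "h n = b" "\<And>i. i \<le> n \<Longrightarrow> h i \<in> graph_morphisms H K"
    "\<And>i. i < n \<Longrightarrow> (h i, h (Suc i)) \<in> parcs (exp_graph K H)"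
    using assms(5) unfolding homotopic_morphisms_def by blast
  define l where "l i = compose (pverts G) g (compose (pverts G) (h i) f)" for i
  have l: "l i \<in> graph_morphisms G L" if "i \<le> n" for i
    unfolding l_def using assms(1) f g h(3)[OF that] by (blast intro: compose_morphism)
  have "(l i, l (Suc i)) \<in> parcs (exp_graph L G)" if "i < n" for i
  proof -
    have "(l i u, l (Suc i) v) \<in> parcs L" if uv: "(u, v) \<in> parcs G" for u v
    proof -
      have "(f u, f v) \<in> parcs H" using f uv by (simp add: graph_morphisms_def)
      then have "(h i (f u), h (Suc i) (f v)) \<in> parcs K"
        using h(4)[OF \<open>i < n\<close>] by (simp add: exp_graph_def)
      then have "(g (h i (f u)), g (h (Suc i) (f v))) \<in> parcs L"
        using g by (simp add: graph_morphisms_def)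
      then show ?thesis using arc_in_verts[OF assms(1) uv] by (simp add: l_def compose_def)
    qed
    moreover have "l i \<in> pverts G \<rightarrow>\<^sub>E pverts L" "l (Suc i) \<in> pverts G \<rightarrow>\<^sub>E pverts L"
      using l[of i] l[of "Suc i"] \<open>i < n\<close> by (simp_all add: graph_morphisms_def)
    ultimately show ?thesis by (simp add: exp_graph_def)
  qed
  then show ?thesis
    using l h(1,2) unfolding homotopic_morphisms_def
    by (intro exI[of _ n] exI[of _ l]) (simp add: l_def)
qed

lemma homotopy_equivalent_graphs_sym:
  "homotopy_equivalent_graphs G H \<Longrightarrow> homotopy_equivalent_graphs H G"
  unfolding homotopy_equivalent_graphs_def by blast

text \<open>Regrouped, the long composite is \<open>g\<close> after \<open>g' f'\<close> after
  \<open>f\<close>. Contracting the inner \<open>g' f'\<close> to the identity leaves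
  \<open>g f\<close>, which is itself homotopic to the identity. This is one half of transitivity;
  the other half is the same statement read from \<open>K\<close> to \<open>G\<close>.\<close>

lemma homotopic_identity_sandwich:
  assumes "pair_wf_digraph G" "pair_wf_digraph H"
    and f: "f \<in> graph_morphisms G H" and g: "g \<in> graph_morphisms H G"
    and f': "f' \<in> graph_morphisms H K" and g': "g' \<in> graph_morphisms K H"
    and gf: "homotopic_morphisms G G (compose (pverts G) g f) (\<lambda>x\<in>pverts G. x)"
    and gf': "homotopic_morphisms H H (compose (pverts H) g' f') (\<lambda>x\<in>pverts H. x)"
  shows "homotopic_morphisms G G
           (compose (pverts G) (compose (pverts K) g g') (compose (pverts G) f' f)) (\<lambda>x\<in>pverts G. x)"
proof -
  \<comment> \<open>\<open>compose\<close> and \<open>restrict\<close> yield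
    \<open>undefined\<close> off their domain, so the regrouping is valid only because
    \<open>f\<close> and \<open>f'\<close> land in the vertex sets on which the next maps are
    defined.\<close>
  have "f x \<in> pverts H" "f' (f x) \<in> pverts K" if "x \<in> pverts G" for x
    using that f f' by (auto simp: graph_morphisms_def PiE_iff)
  then have "compose (pverts G) (compose (pverts K) g g') (compose (pverts G) f' f)
      = compose (pverts G) g (compose (pverts G) (compose (pverts H) g' f') f)"
    and "compose (pverts G) g f
      = compose (pverts G) g (compose (pverts G) (\<lambda>x\<in>pverts H. x) f)"
    by (auto simp: compose_def fun_eq_iff)
  then show ?thesis
    using homotopic_morphisms_compose[OF assms(1,2) f g gf'] gf
    by (simp add: homotopic_morphisms_trans)
qed

lemma homotopy_equivalent_graphs_trans:
  assumes "pair_wf_digraph G" "pair_wf_digraph H" "pair_wf_digraph K"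
    and "homotopy_equivalent_graphs G H" "homotopy_equivalent_graphs H K"
  shows "homotopy_equivalent_graphs G K"
proof -
  obtain f g where fg: "f \<in> graph_morphisms G H" "g \<in> graph_morphisms H G"
    "homotopic_morphisms G G (compose (pverts G) g f) (\<lambda>x\<in>pverts G. x)"
    "homotopic_morphisms H H (compose (pverts H) f g) (\<lambda>x\<in>pverts H. x)"
    using assms(4) unfolding homotopy_equivalent_graphs_def by blast
  obtain f' g' where fg': "f' \<in> graph_morphisms H K" "g' \<in> graph_morphisms K H"
    "homotopic_morphisms H H (compose (pverts H) g' f') (\<lambda>x\<in>pverts H. x)"
    "homotopic_morphisms K K (compose (pverts K) f' g') (\<lambda>x\<in>pverts K. x)"
    using assms(5) unfolding homotopy_equivalent_graphs_def by blast
  show ?thesis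
    unfolding homotopy_equivalent_graphs_def
    using compose_morphism[OF assms(1) fg(1) fg'(1)] compose_morphism[OF assms(3) fg'(2) fg(2)]
      homotopic_identity_sandwich[OF assms(1,2) fg(1,2) fg'(1,2) fg(3) fg'(3)]
      homotopic_identity_sandwich[OF assms(3,2) fg'(2,1) fg(2,1) fg'(4) fg(4)]
    by blast
qed

text \<open>If \<open>w\<close> is a neighbour of \<open>v\<close>, then adjacency of
  \<open>f\<close> to the identity, applied to the edge from \<open>v\<close> to \<open>w\<close>,
  makes \<open>w\<close> a neighbour of \<open>f v\<close>. The resulting inclusion of
  neighbourhoods forces \<open>f v = v\<close> by stiffness.\<close>

lemma stiff_adjacent_identity:
  assumes "pair_wf_digraph P" "stiff P" "(f, \<lambda>x\<in>pverts P. x) \<in> parcs (exp_graph P P)"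
  shows "f = (\<lambda>x\<in>pverts P. x)"
proof -
  have f: "f \<in> pverts P \<rightarrow>\<^sub>E pverts P"
    using assms(3) by (simp add: exp_graph_def)
  have "f v = v" if v: "v \<in> pverts P" for v
  proof -
    have "nbhd P v \<subseteq> nbhd P (f v)"
      using assms(3) by (fastforce simp: nbhd_def exp_graph_def)
    moreover have "f v \<in> pverts P" using f v by auto
    ultimately show ?thesis using assms(2) v unfolding stiff_def by metis
  qed
  then show ?thesis using f by (auto simp: fun_eq_iff PiE_iff extensional_def)
qed

lemma stiff_homotopic_identity:
  assumes "pair_wf_digraph P" "stiff P" "homotopic_morphisms P P f (\<lambda>x\<in>pverts P. x)"
  shows "f = (\<lambda>x\<in>pverts P. x)"
proof -
  obtain n h where h: "h 0 = f" "h n = (\<lambda>x\<in>pverts P. x)"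
    "\<And>i. i < n \<Longrightarrow> (h i, h (Suc i)) \<in> parcs (exp_graph P P)"
    using assms(3) unfolding homotopic_morphisms_def by blast
  have "h 0 = (\<lambda>x\<in>pverts P. x)"
  \<comment> \<open>The induction runs downward from \<open>n\<close>, because the end of the
    homotopy is the point known to be the identity.\<close>
  proof (rule inc_induct[of 0 n])
    show "h i = (\<lambda>x\<in>pverts P. x)" if "i < n" "h (Suc i) = (\<lambda>x\<in>pverts P. x)" for i
      using stiff_adjacent_identity[OF assms(1,2)] h(3)[OF that(1)] that(2) by simp
  qed (use h(2) in simp_all)
  then show ?thesis using h(1) by simp
qed

text \<open>Stiffness upgrades both homotopies to equalities, so \<open>f\<close> and
  \<open>g\<close> are mutually inverse bijections.\<close>

lemma stiff_homotopy_equivalent_imp_iso: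
  assumes "pair_wf_digraph P" "pair_wf_digraph Q" "stiff P" "stiff Q"
    and "homotopy_equivalent_graphs P Q"
  shows "digraph_iso (with_proj P) (with_proj Q)"
proof -
  obtain f g where f: "f \<in> graph_morphisms P Q" and g: "g \<in> graph_morphisms Q P"
    and "homotopic_morphisms P P (compose (pverts P) g f) (\<lambda>x\<in>pverts P. x)"
    and "homotopic_morphisms Q Q (compose (pverts Q) f g) (\<lambda>x\<in>pverts Q. x)"
    using assms(5) unfolding homotopy_equivalent_graphs_def by blast
  then have "compose (pverts P) g f = (\<lambda>x\<in>pverts P. x)"
    and "compose (pverts Q) f g = (\<lambda>x\<in>pverts Q. x)"
    using assms(1-4) by (blast intro: stiff_homotopic_identity)+
  then have gf: "\<And>x. x \<in> pverts P \<Longrightarrow> g (f x) = x" and fg: "\<And>y. y \<in> pverts Q \<Longrightarrow> f (g y) = y"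
    by (metis compose_eq restrict_apply')+
  have "bij_betw f (pverts P) (pverts Q)"
    using f g gf fg by (intro bij_betw_byWitness[where f' = g]) (auto simp: graph_morphisms_def)
  moreover have "(u, v) \<in> parcs P \<longleftrightarrow> (f u, f v) \<in> parcs Q"
    if "u \<in> pverts P" "v \<in> pverts P" for u v
    \<comment> \<open>Edges are reflected because the inverse \<open>g\<close> is a morphism too: it
      sends an edge from \<open>f u\<close> to \<open>f v\<close> back to one from \<open>u\<close>
      to \<open>v\<close>.\<close>
    using f g gf[OF that(1)] gf[OF that(2)] unfolding graph_morphisms_def by force
  ultimately show ?thesis using digraph_iso_with_proj_iff[OF assms(1,2)] by blast
qed

text \<open>The composites with the inverse equal the identities, so homotopies of length zero
  suffice.\<close>

lemma iso_imp_homotopy_equivalent: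
  assumes "pair_wf_digraph P" "pair_wf_digraph Q"
    and "digraph_iso (with_proj P) (with_proj Q)"
  shows "homotopy_equivalent_graphs P Q"
proof -
  obtain f where bij: "bij_betw f (pverts P) (pverts Q)"
    and arc: "\<And>u v. u \<in> pverts P \<Longrightarrow> v \<in> pverts P \<Longrightarrow> (u, v) \<in> parcs P \<longleftrightarrow> (f u, f v) \<in> parcs Q"
    using assms(3) unfolding digraph_iso_with_proj_iff[OF assms(1,2)] by blast
  define g where "g = inv_into (pverts P) f"
  have gf: "g (f x) = x" "f x \<in> pverts Q" if "x \<in> pverts P" for x
    using bij that unfolding g_def by (simp_all add: bij_betw_inv_into_left bij_betw_apply)
  have fg: "f (g y) = y" "g y \<in> pverts P" if "y \<in> pverts Q" for y
    unfolding g_def using bij_betw_inv_into_right[OF bij that]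
      bij_betw_apply[OF bij_betw_inv_into[OF bij] that] by blast+
  \<comment> \<open>The bijection is arbitrary off the vertex set, while
    \<open>graph_morphisms\<close> contains only extensional maps; hence the restrictions.\<close>
  have "(restrict f (pverts P) u, restrict f (pverts P) v) \<in> parcs Q" if "(u, v) \<in> parcs P" for u v
    using that arc arc_in_verts[OF assms(1) that] by simp
  then have f: "restrict f (pverts P) \<in> graph_morphisms P Q"
    using gf(2) by (simp add: graph_morphisms_def restrict_PiE_iff del: restrict_apply)
  have "(restrict g (pverts Q) u, restrict g (pverts Q) v) \<in> parcs P"
    if uv: "(u, v) \<in> parcs Q" for u v
    using uv arc[of "g u" "g v"] fg arc_in_verts[OF assms(2) uv] by simp
  then have g: "restrict g (pverts Q) \<in> graph_morphisms Q P"
    using fg(2) by (simp add: graph_morphisms_def restrict_PiE_iff del: restrict_apply)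
  have "compose (pverts P) (restrict g (pverts Q)) (restrict f (pverts P)) = (\<lambda>x\<in>pverts P. x)"
    "compose (pverts Q) (restrict f (pverts P)) (restrict g (pverts Q)) = (\<lambda>x\<in>pverts Q. x)"
    using gf fg by (auto simp: compose_def fun_eq_iff)
  with f g show ?thesis
    unfolding homotopy_equivalent_graphs_def
    by (metis homotopic_morphisms_refl identity_morphism assms(1,2))
qed

theorem theorem4p19:
  fixes G :: "'a pair_pre_digraph" and H :: "'b pair_pre_digraph"
    and P\<^sub>G :: "'c pair_pre_digraph" and P\<^sub>H :: "'d pair_pre_digraph"
  assumes "pair_pseudo_graph G" and "pair_pseudo_graph H"
    and "pleat_of P\<^sub>G G" and "pleat_of P\<^sub>H H"
  shows "homotopy_equivalent_graphs G H \<longleftrightarrow> digraph_iso (with_proj P\<^sub>G) (with_proj P\<^sub>H)"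
proof -
  have wf: "pair_wf_digraph G" "pair_wf_digraph H" "pair_wf_digraph P\<^sub>G" "pair_wf_digraph P\<^sub>H"
    and st: "stiff P\<^sub>G" "stiff P\<^sub>H"
    and eG: "homotopy_equivalent_graphs P\<^sub>G G" and eH: "homotopy_equivalent_graphs P\<^sub>H H"
    using assms by (auto simp: pleat_of_def intro: pair_wf_digraph_pseudo_graph)
  note sym = homotopy_equivalent_graphs_sym and trans = homotopy_equivalent_graphs_trans
  show ?thesis
  proof
    assume "homotopy_equivalent_graphs G H"
    \<comment> \<open>The chain runs from \<open>P\<^sub>G\<close> through \<open>G\<close> and
      \<open>H\<close> to \<open>P\<^sub>H\<close>.\<close>
    with eG have "homotopy_equivalent_graphs P\<^sub>G H" by (rule trans[OF wf(3,1,2)])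
    then have "homotopy_equivalent_graphs P\<^sub>G P\<^sub>H" using sym[OF eH] by (rule trans[OF wf(3,2,4)])
    with wf(3,4) st show "digraph_iso (with_proj P\<^sub>G) (with_proj P\<^sub>H)"
      by (rule stiff_homotopy_equivalent_imp_iso)
  next
    assume "digraph_iso (with_proj P\<^sub>G) (with_proj P\<^sub>H)"
    with wf(3,4) have "homotopy_equivalent_graphs P\<^sub>G P\<^sub>H" by (rule iso_imp_homotopy_equivalent)
    with sym[OF eG] have "homotopy_equivalent_graphs G P\<^sub>H" by (rule trans[OF wf(1,3,4)])
    then show "homotopy_equivalent_graphs G H" using eH by (rule trans[OF wf(1,4,2)])
  qed
qed

end
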